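(* Let $c>0$ be a real constant, let $u_0\in L^1(\mathbf R)$, put $m=\int_{-\infty}^{+\infty}u_0(x)\,dx$, and let $u(x,t)$ be the solution of the heat equation $u_t=c\,u_{xx}$ ($x\in\mathbf R$, $t>0$) with $u(x,0)=u_0(x)$. Then: (i) $\displaystyle \lim_{t\to\infty}\|u(\cdot,t)\|_1=|m|$; (ii) for every $1\le p<\infty$, $\displaystyle \lim_{t\to\infty}t^{\frac12\left(1-\frac1p\right)}\|u(\cdot,t)\|_p=\frac{|m|}{\sqrt{4\pi c}}\left(\frac{4\pi c}{p}\right)^{\frac1{2p}}$; (iii) $\displaystyle \lim_{t\to\infty}t^{\frac12}\|u(\cdot,t)\|_\infty=\frac{|m|}{\sqrt{4\pi c}}$.
   Context: Functions are real-valued. For fixed $t$, $\|u(\cdot,t)\|_p$ denotes the $L^p(\mathbf R)$ norm of $x\mapsto u(x,t)$: $\left(\int_{-\infty}^{+\infty}|u(x,t)|^p\,dx\right)^{1/p}$ if $1\le p<\infty$, and $\sup_{x\in\mathbf R}|u(x,t)|$ if $p=\infty$. The initial condition is meant in the sense that $\|u(\cdot,t)-u_0\|_1\to0$ as $t\to0$, $t>0$. The solution is given, for $t>0$, by $$u(x,t)=\frac1{\sqrt{4\pi ct}}\int_{-\infty}^{+\infty}e^{-\frac{(x-y)^2}{4ct}}\,u_0(y)\,dy .$$ *)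

theory Defs
  imports "HOL-Analysis.Analysis"
begin

text \<open>The norms take values in \<^typ>\<open>ennreal\<close>, so that a function outside the space has
  norm \<open>\<infinity>\<close>. A real-valued norm built on the Bochner integral or on the real supremum would
  assign such a function an arbitrary finite value.\<close>

definition Lp_norm :: "real \<Rightarrow> (real \<Rightarrow> real) \<Rightarrow> ennreal" where
  "Lp_norm p f =
     (let I = (\<integral>\<^sup>+ x. ennreal (\<bar>f x\<bar> powr p) \<partial>lebesgue)
      in if I = \<infinity> then \<infinity> else ennreal (enn2real I powr (1 / p)))"

definition Linf_norm :: "(real \<Rightarrow> real) \<Rightarrow> ennreal" where
  "Linf_norm f = (SUP x. ennreal \<bar>f x\<bar>)"

text \<open>Space comes first: \<open>u x t\<close> stands for $u(x,t)$. Values of \<open>u\<close> at \<open>t \<le> 0\<close> are irrelevant.\<close>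

definition solves_heat_equation :: "real \<Rightarrow> (real \<Rightarrow> real \<Rightarrow> real) \<Rightarrow> bool" where
  "solves_heat_equation c u \<longleftrightarrow>
     (\<exists>ut ux uxx. \<forall>x. \<forall>t>0.
        ((\<lambda>s. u x s) has_real_derivative ut x t) (at t) \<and>
        ((\<lambda>y. u y t) has_real_derivative ux x t) (at x) \<and>
        ((\<lambda>y. ux y t) has_real_derivative uxx x t) (at x) \<and>
        ut x t = c * uxx x t)"

definition has_initial_value :: "(real \<Rightarrow> real \<Rightarrow> real) \<Rightarrow> (real \<Rightarrow> real) \<Rightarrow> bool" where
  "has_initial_value u u0 \<longleftrightarrow> ((\<lambda>t. Lp_norm 1 (\<lambda>x. u x t - u0 x)) \<longlongrightarrow> 0) (at_right 0)"

text \<open>The differential equation and the initial value alone do not single out a solution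
  (Tychonoff's null solutions, started at a positive time, can be added); the representation
  by the heat kernel does.\<close>

definition heat_representation ::
    "real \<Rightarrow> (real \<Rightarrow> real) \<Rightarrow> (real \<Rightarrow> real \<Rightarrow> real) \<Rightarrow> bool" where
  "heat_representation c u0 u \<longleftrightarrow>
     (\<forall>x. \<forall>t>0. u x t =
        1 / sqrt (4 * pi * c * t) *
        (\<integral>y. exp (- ((x - y)\<^sup>2 / (4 * c * t))) * u0 y \<partial>lebesgue))"

end

theory Submission
  imports Defs "HOL-Probability.Distributions"
begin

text \<open>The heat equation is invariant under \<open>(x, t) \<mapsto> (s x, s\<^sup>2 t)\<close>, so the natural object is the
  rescaled solution \<open>v\<^sub>s(x) = s u(s x, s\<^sup>2)\<close>. Substituting into the heat kernel representation gives
  \<open>v\<^sub>s(x) = \<integral> G(x - y/s) u\<^sub>0(y) dy\<close>, where \<open>G\<close> is the kernel at time one. In these coordinates the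
  initial mass is squeezed into the origin as \<open>s \<rightarrow> \<infinity>\<close>, so that \<open>v\<^sub>s\<close> should approach \<open>m G\<close>. Moreover
  \<open>t\<^bsup>(1-1/p)/2\<^esup> \<parallel>u(\<cdot>,t)\<parallel>\<^sub>p\<close> with \<open>t = s\<^sup>2\<close> is exactly \<open>\<parallel>v\<^sub>s\<parallel>\<^sub>p\<close>, and the three limits in question are
  \<open>\<parallel>m G\<parallel>\<^sub>1\<close>, \<open>\<parallel>m G\<parallel>\<^sub>p\<close> and \<open>\<parallel>m G\<parallel>\<^sub>\<infinity>\<close>.

  The difference is \<open>v\<^sub>s(x) - m G(x) = \<integral> (G(x - y/s) - G(x)) u\<^sub>0(y) dy\<close>, which tends to zero in two
  senses. In \<open>L\<^sup>1\<close> (\<open>rescaled_L1_convergence\<close>), Tonelli's theorem bounds its norm by the integral of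
  \<open>\<bar>u\<^sub>0(y)\<bar>\<close> against the \<open>L\<^sup>1\<close> modulus of continuity of \<open>G\<close> at the shift \<open>y/s\<close>; dominated convergence
  applies. Uniformly in \<open>x\<close> (\<open>rescaled_uniform_convergence\<close>), the same argument works with the
  supremum modulus, because \<open>G\<close> is bounded and Lipschitz.

  The case of finite \<open>p\<close> (\<open>rescaled_Lp_convergence\<close>) needs no further estimate in \<open>L\<^sup>p\<close>: all
  \<open>v\<^sub>s\<close> share one bound, and on a bounded interval \<open>z \<mapsto> z\<^sup>p\<close> is Lipschitz, so that \<open>L\<^sup>1\<close> convergence
  carries over to the integrals of the \<open>p\<close>-th powers. The Gaussian integral of \<open>G\<^sup>p\<close> gives the
  constant.\<close>

section \<open>The heat kernel at time one\<close>

definition heat_kernel :: "real \<Rightarrow> real \<Rightarrow> real" where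
  "heat_kernel c x = exp (- (x\<^sup>2 / (4 * c))) / sqrt (4 * pi * c)"

lemma heat_kernel_eq_normal_density:
  assumes "c > 0"
  shows "heat_kernel c (x - h) = normal_density h (sqrt (2 * c)) x"
  using assms by (simp add: heat_kernel_def normal_density_def field_simps)

lemma borel_measurable_heat_kernel [measurable]: "heat_kernel c \<in> borel_measurable borel"
  unfolding heat_kernel_def by measurable

lemma heat_kernel_nonneg [simp]: "c > 0 \<Longrightarrow> heat_kernel c x \<ge> 0"
  by (simp add: heat_kernel_def)

lemma heat_kernel_le: "c > 0 \<Longrightarrow> heat_kernel c x \<le> 1 / sqrt (4 * pi * c)"
  by (simp add: heat_kernel_def divide_right_mono)

lemma heat_kernel_0: "heat_kernel c 0 = 1 / sqrt (4 * pi * c)"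
  by (simp add: heat_kernel_def)

lemma integrable_heat_kernel_shift:
  assumes "c > 0"
  shows "integrable lborel (\<lambda>x. heat_kernel c (x - h))"
  using assms by (simp add: heat_kernel_eq_normal_density)

lemma integrable_heat_kernel: "c > 0 \<Longrightarrow> integrable lborel (heat_kernel c)"
  using integrable_heat_kernel_shift[of c 0] by simp

lemma integral_heat_kernel_shift:
  assumes "c > 0"
  shows "(\<integral>x. heat_kernel c (x - h) \<partial>lborel) = 1"
  using assms by (simp add: heat_kernel_eq_normal_density)

text \<open>A power of a Gaussian is again a Gaussian, with variance divided by \<open>p\<close>; comparing the
  normalising constants gives the value of the integral.\<close>

lemma has_bochner_integral_heat_kernel_powr:
  assumes "c > 0" "p > 0"
  shows "has_bochner_integral lborel (\<lambda>x. heat_kernel c x powr p)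
           ((1 / sqrt (4 * pi * c)) powr p * sqrt (4 * pi * c / p))"
proof -
  let ?C = "(1 / sqrt (4 * pi * c)) powr p * sqrt (4 * pi * c / p)"
  have eq: "heat_kernel c x powr p = ?C * normal_density 0 (sqrt (2 * c / p)) x" for x
  proof -
    have "heat_kernel c x powr p
        = (1 / sqrt (4 * pi * c)) powr p * exp (- (x\<^sup>2 / (4 * c))) powr p"
      using assms by (simp add: heat_kernel_def powr_divide)
    also have "exp (- (x\<^sup>2 / (4 * c))) powr p = exp (- (x\<^sup>2 / (4 * c / p)))"
      by (simp add: powr_def)
    also have "exp (- (x\<^sup>2 / (4 * c / p)))
        = sqrt (4 * pi * c / p) * normal_density 0 (sqrt (2 * c / p)) x"
      using assms by (simp add: normal_density_def field_simps)
    finally show ?thesis by simp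
  qed
  have "has_bochner_integral lborel (normal_density 0 (sqrt (2 * c / p))) 1"
    using assms by (simp add: has_bochner_integral_iff)
  then have "has_bochner_integral lborel
      (\<lambda>x. ?C * normal_density 0 (sqrt (2 * c / p)) x) (?C * 1)"
    by (intro has_bochner_integral_mult_right) auto
  then show ?thesis unfolding eq by simp
qed

text \<open>The derivative is \<open>-(x / 2c) G(x)\<close>, and \<open>e\<^sup>z \<ge> 1 + z\<close> together with
  \<open>1 + a\<^sup>2 \<ge> 2 a\<close> for \<open>a = \<bar>x\<bar> / (2 \<surd>c)\<close> keeps it bounded.\<close>

lemma heat_kernel_Lipschitz:
  assumes "c > 0"
  obtains L where "\<And>x y. \<bar>heat_kernel c x - heat_kernel c y\<bar> \<le> L * \<bar>x - y\<bar>"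
proof -
  define L where "L = sqrt c / (2 * c * sqrt (4 * pi * c))"
  have deriv: "(heat_kernel c has_real_derivative - x / (2 * c) * heat_kernel c x) (at x)" for x
    unfolding heat_kernel_def using assms
    by (auto intro!: derivative_eq_intros simp: field_simps)
  have "\<bar>x\<bar> * exp (- (x\<^sup>2 / (4 * c))) \<le> sqrt c" for x :: real
  proof -
    have "0 \<le> (\<bar>x\<bar> / (2 * sqrt c) - 1)\<^sup>2" by simp
    also have "(\<bar>x\<bar> / (2 * sqrt c) - 1)\<^sup>2 = 1 + x\<^sup>2 / (4 * c) - \<bar>x\<bar> / sqrt c"
      using assms by (simp add: power2_diff power_divide power_mult_distrib)
    finally have "\<bar>x\<bar> / sqrt c \<le> exp (x\<^sup>2 / (4 * c))"
      using exp_ge_add_one_self[of "x\<^sup>2 / (4 * c)"] by linarith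
    then show ?thesis using assms by (simp add: exp_minus field_simps)
  qed
  then have bound: "norm (- x / (2 * c) * heat_kernel c x) \<le> L" for x
    using assms by (simp add: heat_kernel_def L_def abs_mult divide_simps mult.commute)
  have "\<bar>heat_kernel c x - heat_kernel c y\<bar> \<le> L * \<bar>x - y\<bar>" for x y
    using field_differentiable_bound[of UNIV "heat_kernel c"
        "\<lambda>x. - x / (2 * c) * heat_kernel c x" L x y] deriv bound
    by simp
  then show ?thesis by (rule that)
qed

section \<open>Shrinking translations of the heat kernel\<close>

lemma heat_kernel_shift_tendsto:
  assumes "c > 0"
  shows "((\<lambda>s. heat_kernel c (x - h / s)) \<longlongrightarrow> heat_kernel c x) at_top"
proof -
  have "((\<lambda>s. x - h / s) \<longlongrightarrow> x - 0) at_top"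
    by (intro tendsto_diff tendsto_const tendsto_divide_0[OF tendsto_const]
        filterlim_at_top_imp_at_infinity filterlim_ident)
  moreover have "isCont (heat_kernel c) x"
    unfolding heat_kernel_def using assms by (intro continuous_intros) auto
  ultimately show ?thesis by (intro isCont_tendsto_compose[where g = "heat_kernel c"]) auto
qed

definition L1_modulus :: "real \<Rightarrow> real \<Rightarrow> real" where
  "L1_modulus c h = (\<integral>x. \<bar>heat_kernel c (x - h) - heat_kernel c x\<bar> \<partial>lborel)"

lemma borel_measurable_L1_modulus [measurable]: "L1_modulus c \<in> borel_measurable borel"
  unfolding L1_modulus_def by measurable

lemma integrable_heat_kernel_shift_diff:
  assumes "c > 0"
  shows "integrable lborel (\<lambda>x. \<bar>heat_kernel c (x - h) - heat_kernel c x\<bar>)"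
  using assms by (intro integrable_abs Bochner_Integration.integrable_diff
      integrable_heat_kernel_shift integrable_heat_kernel)

lemma L1_modulus_nonneg: "L1_modulus c h \<ge> 0"
  by (simp add: L1_modulus_def)

lemma L1_modulus_le_2:
  assumes "c > 0"
  shows "L1_modulus c h \<le> 2"
proof -
  have "L1_modulus c h \<le> (\<integral>x. heat_kernel c (x - h) + heat_kernel c x \<partial>lborel)"
    unfolding L1_modulus_def
  proof (rule integral_mono)
    show "\<bar>heat_kernel c (x - h) - heat_kernel c x\<bar> \<le> heat_kernel c (x - h) + heat_kernel c x"
      for x
      using heat_kernel_nonneg[OF assms, of x] heat_kernel_nonneg[OF assms, of "x - h"] by linarith
  qed (use assms in \<open>auto intro!: integrable_heat_kernel_shift_diff integrable_heat_kernel_shift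
        integrable_heat_kernel Bochner_Integration.integrable_add\<close>)
  also have "\<dots> = 2"
    using assms integral_heat_kernel_shift[of c h] integral_heat_kernel_shift[of c 0]
    by (subst Bochner_Integration.integral_add)
      (auto intro: integrable_heat_kernel_shift integrable_heat_kernel)
  finally show ?thesis .
qed

text \<open>For shifts of size at most one, the translates have a common integrable majorant: since
  \<open>(x - h)\<^sup>2 \<ge> x\<^sup>2/2 - h\<^sup>2\<close>, they lie below a multiple of the wider Gaussian with parameter \<open>2 c\<close>.\<close>

lemma heat_kernel_shift_majorant:
  assumes "c > 0" "\<bar>h\<bar> \<le> 1"
  shows "heat_kernel c (x - h) \<le> exp (1 / (4 * c)) * sqrt 2 * heat_kernel (2 * c) x"
proof -
  have "0 \<le> (x - 2 * h)\<^sup>2" by simp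
  moreover have "h\<^sup>2 \<le> 1" using assms by (simp add: abs_square_le_1)
  ultimately have "x\<^sup>2 - 2 * (x - h)\<^sup>2 \<le> 2"
    by (simp add: power2_diff power_mult_distrib)
  then have "- ((x - h)\<^sup>2 / (4 * c)) \<le> 1 / (4 * c) - x\<^sup>2 / (8 * c)"
    using assms by (simp add: field_simps)
  then have "exp (- ((x - h)\<^sup>2 / (4 * c))) \<le> exp (1 / (4 * c)) * exp (- (x\<^sup>2 / (8 * c)))"
    by (simp flip: exp_add)
  then have "heat_kernel c (x - h)
      \<le> exp (1 / (4 * c)) * exp (- (x\<^sup>2 / (8 * c))) / sqrt (4 * pi * c)"
    using assms unfolding heat_kernel_def by (intro divide_right_mono) auto
  also have "\<dots> = exp (1 / (4 * c)) * sqrt 2 * heat_kernel (2 * c) x"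
    using assms real_sqrt_mult[of 2 4] by (simp add: heat_kernel_def real_sqrt_mult field_simps)
  finally show ?thesis .
qed

lemma L1_modulus_tendsto_0:
  assumes "c > 0"
  shows "((\<lambda>s. L1_modulus c (h / s)) \<longlongrightarrow> 0) at_top"
proof -
  let ?w = "\<lambda>x. 2 * (exp (1 / (4 * c)) * sqrt 2 * heat_kernel (2 * c) x)"
  have "((\<lambda>s. \<integral>x. \<bar>heat_kernel c (x - h / s) - heat_kernel c x\<bar> \<partial>lborel)
      \<longlongrightarrow> (\<integral>x. 0 \<partial>(lborel :: real measure))) at_top"
  proof (rule integral_dominated_convergence_at_top)
    show "integrable lborel ?w"
      using assms by (intro integrable_mult_right integrable_heat_kernel) auto
    show "AE x in lborel. ((\<lambda>s. \<bar>heat_kernel c (x - h / s) - heat_kernel c x\<bar>) \<longlongrightarrow> 0) at_top"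
      by (intro AE_I2 tendsto_rabs_zero LIM_zero heat_kernel_shift_tendsto assms)
    show "\<forall>\<^sub>F s in at_top. AE x in lborel.
        norm \<bar>heat_kernel c (x - h / s) - heat_kernel c x\<bar> \<le> ?w x"
      using eventually_ge_at_top[of "max 1 \<bar>h\<bar>"]
    proof eventually_elim
      case (elim s)
      then have "\<bar>h / s\<bar> \<le> 1" by simp
      then have "norm \<bar>heat_kernel c (x - h / s) - heat_kernel c x\<bar> \<le> ?w x" for x
        using heat_kernel_shift_majorant[OF assms, of "h / s" x]
          heat_kernel_shift_majorant[OF assms, of 0 x]
          heat_kernel_nonneg[OF assms, of x] heat_kernel_nonneg[OF assms, of "x - h / s"]
        by (simp add: abs_le_iff)
      then show ?case by simp
    qed
  qed measurable
  then show ?thesis by (simp add: L1_modulus_def)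
qed

section \<open>Convergence of the rescaled solution\<close>

text \<open>This is \<open>v\<^sub>s(x) = s u(s x, s\<^sup>2)\<close> for the solution \<open>u\<close> with initial value \<open>w\<close>, see
  \<open>heat_representation_rescaled\<close>. Written as an integral against the fixed kernel at time one, it
  depends on \<open>s\<close> only through the shift \<open>y / s\<close>.\<close>

definition rescaled :: "real \<Rightarrow> (real \<Rightarrow> real) \<Rightarrow> real \<Rightarrow> real \<Rightarrow> real" where
  "rescaled c w s x = (\<integral>y. heat_kernel c (x - y / s) * w y \<partial>lborel)"

lemma borel_measurable_rescaled [measurable]:
  assumes [measurable]: "w \<in> borel_measurable borel"
  shows "rescaled c w s \<in> borel_measurable borel"
  unfolding rescaled_def by measurable

lemma integrable_bounded_mult:
  fixes f w :: "real \<Rightarrow> real"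
  assumes w: "integrable lborel w" and [measurable]: "f \<in> borel_measurable borel"
    and bound: "\<And>y. \<bar>f y\<bar> \<le> K"
  shows "integrable lborel (\<lambda>y. f y * w y)"
proof (rule Bochner_Integration.integrable_bound)
  have [measurable]: "w \<in> borel_measurable borel"
    using borel_measurable_integrable[OF w] by simp
  show "integrable lborel (\<lambda>y. K * w y)" using w by simp
  show "(\<lambda>y. f y * w y) \<in> borel_measurable lborel" by measurable
  have "\<bar>f y\<bar> \<le> \<bar>K\<bar>" for y using bound[of y] by linarith
  then show "AE y in lborel. norm (f y * w y) \<le> norm (K * w y)"
    by (auto simp: abs_mult intro!: mult_right_mono)
qed

lemma integrable_rescaled_kernel:
  assumes "c > 0" "integrable lborel w"
  shows "integrable lborel (\<lambda>y. heat_kernel c (x - y / s) * w y)"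
  using assms heat_kernel_le[of c]
  by (intro integrable_bounded_mult[where K = "1 / sqrt (4 * pi * c)"]) auto

lemma rescaled_bound:
  assumes "c > 0" "integrable lborel w"
  shows "\<bar>rescaled c w s x\<bar> \<le> 1 / sqrt (4 * pi * c) * (\<integral>y. \<bar>w y\<bar> \<partial>lborel)"
proof -
  have "\<bar>rescaled c w s x\<bar> \<le> (\<integral>y. \<bar>heat_kernel c (x - y / s) * w y\<bar> \<partial>lborel)"
    unfolding rescaled_def by (rule integral_abs_bound)
  also have "\<dots> \<le> (\<integral>y. 1 / sqrt (4 * pi * c) * \<bar>w y\<bar> \<partial>lborel)"
    using assms heat_kernel_le[of c]
    by (intro integral_mono integrable_abs integrable_rescaled_kernel integrable_mult_right)
      (auto simp: abs_mult intro!: mult_right_mono simp del: times_divide_eq_left)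
  finally show ?thesis by simp
qed

lemma integrable_rescaled_diff:
  assumes "c > 0" "integrable lborel w"
  shows "integrable lborel (\<lambda>y. (heat_kernel c (x - y / s) - heat_kernel c x) * w y)"
  using assms integrable_rescaled_kernel[OF assms] by (simp add: left_diff_distrib)

lemma rescaled_minus_limit:
  assumes "c > 0" "integrable lborel w"
  shows "rescaled c w s x - (\<integral>y. w y \<partial>lborel) * heat_kernel c x
       = (\<integral>y. (heat_kernel c (x - y / s) - heat_kernel c x) * w y \<partial>lborel)"
  using assms integrable_rescaled_kernel[OF assms]
  by (simp add: rescaled_def left_diff_distrib)

lemma rescaled_minus_limit_bound:
  assumes "c > 0" and w: "integrable lborel w"
  shows "ennreal \<bar>rescaled c w s x - (\<integral>y. w y \<partial>lborel) * heat_kernel c x\<bar>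
       \<le> (\<integral>\<^sup>+y. ennreal (\<bar>heat_kernel c (x - y / s) - heat_kernel c x\<bar> * \<bar>w y\<bar>) \<partial>lborel)"
  unfolding rescaled_minus_limit[OF assms]
  using integral_norm_bound_ennreal[OF integrable_rescaled_diff[OF assms]]
  by (simp add: abs_mult)

text \<open>Exchanging the order of integration leaves \<open>\<bar>w\<bar>\<close> integrated against the \<open>L\<^sup>1\<close> modulus of
  continuity, which is at most two and tends to zero pointwise.\<close>

lemma rescaled_L1_convergence:
  assumes c: "c > 0" and w: "integrable lborel w"
  defines "d \<equiv> \<lambda>s x. rescaled c w s x - (\<integral>y. w y \<partial>lborel) * heat_kernel c x"
  shows "integrable lborel (d s)" and "((\<lambda>s. \<integral>x. \<bar>d s x\<bar> \<partial>lborel) \<longlongrightarrow> 0) at_top"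
proof -
  define D where "D s = (\<integral>y. L1_modulus c (y / s) * \<bar>w y\<bar> \<partial>lborel)" for s
  have [measurable]: "w \<in> borel_measurable borel"
    using borel_measurable_integrable[OF w] by simp
  have [measurable]: "d s \<in> borel_measurable borel" for s
    unfolding d_def by measurable
  have bound: "(\<integral>\<^sup>+x. ennreal \<bar>d s x\<bar> \<partial>lborel) \<le> ennreal (D s)" for s
  proof -
    have "(\<integral>\<^sup>+x. ennreal \<bar>d s x\<bar> \<partial>lborel)
        \<le> (\<integral>\<^sup>+x. \<integral>\<^sup>+y. ennreal (\<bar>heat_kernel c (x - y / s) - heat_kernel c x\<bar> * \<bar>w y\<bar>)
            \<partial>lborel \<partial>lborel)"
      unfolding d_def by (intro nn_integral_mono rescaled_minus_limit_bound c w)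
    also have "\<dots> = (\<integral>\<^sup>+y. \<integral>\<^sup>+x. ennreal (\<bar>heat_kernel c (x - y / s) - heat_kernel c x\<bar> * \<bar>w y\<bar>)
            \<partial>lborel \<partial>lborel)"
      by (rule lborel_pair.Fubini') measurable
    also have "\<dots> = (\<integral>\<^sup>+y. ennreal (L1_modulus c (y / s) * \<bar>w y\<bar>) \<partial>lborel)"
      by (subst nn_integral_eq_integral)
        (auto simp: L1_modulus_def intro!: integrable_mult_left integrable_heat_kernel_shift_diff c)
    also have "\<dots> = ennreal (D s)"
      unfolding D_def using L1_modulus_le_2[OF c] L1_modulus_nonneg[of c] w
      by (intro nn_integral_eq_integral integrable_bounded_mult[where K = 2]) auto
    finally show ?thesis .
  qed
  show int: "integrable lborel (d s)" for s
    using bound[of s] by (intro integrableI_bounded) (auto simp: le_less_trans)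
  have "(D \<longlongrightarrow> (\<integral>y. 0 \<partial>(lborel :: real measure))) at_top"
    unfolding D_def
  proof (rule integral_dominated_convergence_at_top)
    show "integrable lborel (\<lambda>y. 2 * \<bar>w y\<bar>)" using w by simp
    show "AE y in lborel. ((\<lambda>s. L1_modulus c (y / s) * \<bar>w y\<bar>) \<longlongrightarrow> 0) at_top"
      by (auto intro!: tendsto_mult_left_zero L1_modulus_tendsto_0 c)
    show "\<forall>\<^sub>F s in at_top. AE y in lborel. norm (L1_modulus c (y / s) * \<bar>w y\<bar>) \<le> 2 * \<bar>w y\<bar>"
      using L1_modulus_le_2[OF c] L1_modulus_nonneg[of c]
      by (auto simp: abs_mult intro!: always_eventually mult_right_mono)
  qed measurable
  then have "(D \<longlongrightarrow> 0) at_top" by simp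
  moreover have "norm (\<integral>x. \<bar>d s x\<bar> \<partial>lborel) \<le> D s" for s
  proof -
    have "ennreal (\<integral>x. \<bar>d s x\<bar> \<partial>lborel) \<le> ennreal (D s)"
      using bound[of s] int[of s] by (subst nn_integral_eq_integral[symmetric]) auto
    moreover have "D s \<ge> 0"
      unfolding D_def by (auto intro!: integral_nonneg_AE simp: L1_modulus_nonneg)
    ultimately show ?thesis by simp
  qed
  ultimately show "((\<lambda>s. \<integral>x. \<bar>d s x\<bar> \<partial>lborel) \<longlongrightarrow> 0) at_top"
    by (rule Lim_null_comparison[OF always_eventually[OF allI], rotated])
qed

text \<open>The Lipschitz bound alone would require a first moment of \<open>w\<close>; cutting it off at the
  supremum bound makes the integrand dominated by a multiple of \<open>\<bar>w\<bar>\<close>.\<close>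

lemma rescaled_uniform_convergence:
  assumes c: "c > 0" and w: "integrable lborel w"
  obtains \<delta> where "(\<delta> \<longlongrightarrow> 0) at_top"
    "\<And>s x. \<bar>rescaled c w s x - (\<integral>y. w y \<partial>lborel) * heat_kernel c x\<bar> \<le> \<delta> s"
proof -
  obtain L where L: "\<And>x y. \<bar>heat_kernel c x - heat_kernel c y\<bar> \<le> L * \<bar>x - y\<bar>"
    using heat_kernel_Lipschitz[OF c] by blast
  define K where "K = 1 / sqrt (4 * pi * c)"
  define \<omega> where "\<omega> h = min K (L * \<bar>h\<bar>)" for h
  define \<delta> where "\<delta> s = (\<integral>y. \<omega> (y / s) * \<bar>w y\<bar> \<partial>lborel)" for s
  have [measurable]: "w \<in> borel_measurable borel"
    using borel_measurable_integrable[OF w] by simp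
  have [measurable]: "\<omega> \<in> borel_measurable borel"
    unfolding \<omega>_def by measurable
  have diff: "\<bar>heat_kernel c (x - h) - heat_kernel c x\<bar> \<le> \<omega> h" for x h
    using L[of "x - h" x] heat_kernel_le[OF c, of "x - h"] heat_kernel_le[OF c, of x]
      heat_kernel_nonneg[OF c, of x] heat_kernel_nonneg[OF c, of "x - h"]
    unfolding \<omega>_def K_def by (simp add: abs_le_iff del: heat_kernel_nonneg)
  have \<omega>_nonneg: "\<omega> h \<ge> 0" for h using diff[of 0 h] by linarith
  have \<omega>_le: "\<omega> h \<le> K" for h by (simp add: \<omega>_def)
  have \<omega>_lim: "((\<lambda>s. \<omega> (y / s)) \<longlongrightarrow> 0) at_top" for y
  proof -
    have "((\<lambda>s. \<omega> (y / s)) \<longlongrightarrow> min K (L * \<bar>0\<bar>)) at_top"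
      unfolding \<omega>_def
      by (intro tendsto_min tendsto_const tendsto_mult tendsto_rabs
          tendsto_divide_0[OF tendsto_const] filterlim_at_top_imp_at_infinity filterlim_ident)
    then show ?thesis using c by (simp add: K_def)
  qed
  have int: "integrable lborel (\<lambda>y. \<omega> (y / s) * \<bar>w y\<bar>)" for s
    using \<omega>_nonneg \<omega>_le w by (intro integrable_bounded_mult[where K = K]) auto
  have "(\<delta> \<longlongrightarrow> (\<integral>y. 0 \<partial>(lborel :: real measure))) at_top"
    unfolding \<delta>_def
  proof (rule integral_dominated_convergence_at_top)
    show "integrable lborel (\<lambda>y. K * \<bar>w y\<bar>)" using w by simp
    show "AE y in lborel. ((\<lambda>s. \<omega> (y / s) * \<bar>w y\<bar>) \<longlongrightarrow> 0) at_top"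
      by (auto intro!: tendsto_mult_left_zero \<omega>_lim)
    show "\<forall>\<^sub>F s in at_top. AE y in lborel. norm (\<omega> (y / s) * \<bar>w y\<bar>) \<le> K * \<bar>w y\<bar>"
      using \<omega>_nonneg \<omega>_le
      by (auto simp: abs_mult intro!: always_eventually mult_right_mono)
  qed measurable
  moreover have "\<bar>rescaled c w s x - (\<integral>y. w y \<partial>lborel) * heat_kernel c x\<bar> \<le> \<delta> s" for s x
  proof -
    have "\<bar>rescaled c w s x - (\<integral>y. w y \<partial>lborel) * heat_kernel c x\<bar>
        \<le> (\<integral>y. \<bar>(heat_kernel c (x - y / s) - heat_kernel c x) * w y\<bar> \<partial>lborel)"
      unfolding rescaled_minus_limit[OF c w] by (rule integral_abs_bound)
    also have "\<dots> \<le> \<delta> s"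
      unfolding \<delta>_def
      by (intro integral_mono int integrable_abs integrable_rescaled_diff c w)
        (auto simp: abs_mult intro!: mult_right_mono diff)
    finally show ?thesis .
  qed
  ultimately show ?thesis by (intro that[of \<delta>]) auto
qed

lemma powr_Lipschitz_on_bounded:
  fixes a b M p :: real
  assumes "p \<ge> 1" "0 \<le> a" "a \<le> M" "0 \<le> b" "b \<le> M"
  shows "\<bar>a powr p - b powr p\<bar> \<le> p * M powr (p - 1) * \<bar>a - b\<bar>"
  using assms(2-)
proof (induction a b rule: linorder_wlog)
  case (le a b)
  show ?case
  proof (cases "a = b")
    case False
    with le have "a < b" by simp
    \<comment> \<open>The mean value theorem is applied on the open interval, as \<open>powr\<close> need not be
      differentiable at \<open>0\<close>.\<close>
    moreover have "continuous_on {a..b} (\<lambda>z. z powr p)"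
      using le \<open>p \<ge> 1\<close> by (intro continuous_on_powr' continuous_intros) auto
    moreover have D: "((\<lambda>z. z powr p) has_real_derivative p * z powr (p - 1)) (at z)"
      if "a < z" for z
      using that le by (intro has_real_derivative_powr) auto
    ultimately obtain l z where z: "a < z" "z < b" "((\<lambda>z. z powr p) has_real_derivative l) (at z)"
      "b powr p - a powr p = (b - a) * l"
      using MVT[of a b "\<lambda>z. z powr p"] real_differentiable_def by metis
    from D[OF z(1)] z(3) have "l = p * z powr (p - 1)" using DERIV_unique by blast
    moreover have "z powr (p - 1) \<le> M powr (p - 1)"
      using z le \<open>p \<ge> 1\<close> by (intro powr_mono2) auto
    ultimately have "b powr p - a powr p \<le> (b - a) * (p * M powr (p - 1))"
      using z(4) \<open>a < b\<close> \<open>p \<ge> 1\<close> by (simp add: mult_left_mono)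
    moreover have "a powr p \<le> b powr p" using le \<open>p \<ge> 1\<close> by (intro powr_mono2) auto
    ultimately show ?thesis using \<open>a < b\<close> by (simp add: mult_ac)
  qed simp
next
  case (sym a b)
  then show ?case by (simp add: abs_minus_commute)
qed

text \<open>Comparing \<open>\<bar>f\<bar>\<^sup>p\<close> with \<open>0\<^sup>p\<close> by the Lipschitz bound majorises it by a multiple of \<open>\<bar>f\<bar>\<close>.\<close>

lemma integrable_powr_bounded:
  fixes f :: "real \<Rightarrow> real"
  assumes f: "integrable lborel f" and bound: "\<And>x. \<bar>f x\<bar> \<le> M" and "p \<ge> 1"
  shows "integrable lborel (\<lambda>x. \<bar>f x\<bar> powr p)"
proof (rule Bochner_Integration.integrable_bound)
  have [measurable]: "f \<in> borel_measurable borel"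
    using borel_measurable_integrable[OF f] by simp
  show "integrable lborel (\<lambda>x. p * M powr (p - 1) * f x)" using f by simp
  show "(\<lambda>x. \<bar>f x\<bar> powr p) \<in> borel_measurable lborel" by measurable
  have "\<bar>f x\<bar> powr p \<le> p * M powr (p - 1) * \<bar>f x\<bar>" for x
    using powr_Lipschitz_on_bounded[of p "\<bar>f x\<bar>" M 0] bound[of x] \<open>p \<ge> 1\<close> by auto
  then show "AE x in lborel. norm (\<bar>f x\<bar> powr p) \<le> norm (p * M powr (p - 1) * f x)"
    using \<open>p \<ge> 1\<close> by (simp add: abs_mult)
qed

lemma rescaled_Lp_convergence:
  assumes c: "c > 0" and w: "integrable lborel w" and p: "p \<ge> 1"
  defines "m \<equiv> (\<integral>y. w y \<partial>lborel)"
  shows "integrable lborel (\<lambda>x. \<bar>rescaled c w s x\<bar> powr p)"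
    and "((\<lambda>s. \<integral>x. \<bar>rescaled c w s x\<bar> powr p \<partial>lborel)
      \<longlongrightarrow> (\<bar>m\<bar> / sqrt (4 * pi * c)) powr p * sqrt (4 * pi * c / p)) at_top"
proof -
  define M where "M = 1 / sqrt (4 * pi * c) * (\<integral>y. \<bar>w y\<bar> \<partial>lborel)"
  define d where "d s x = rescaled c w s x - m * heat_kernel c x" for s x
  have d: "integrable lborel (d s)" "((\<lambda>s. \<integral>x. \<bar>d s x\<bar> \<partial>lborel) \<longlongrightarrow> 0) at_top" for s
    using rescaled_L1_convergence[OF c w] unfolding d_def m_def by auto
  have lim: "integrable lborel (\<lambda>x. m * heat_kernel c x)"
    using integrable_heat_kernel[OF c] by simp
  have "integrable lborel (\<lambda>x. d s x + m * heat_kernel c x)" for s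
    by (intro Bochner_Integration.integrable_add d lim)
  then have v: "integrable lborel (rescaled c w s)" for s by (simp add: d_def)
  have v_bound: "\<bar>rescaled c w s x\<bar> \<le> M" for s x
    unfolding M_def by (rule rescaled_bound[OF c w])
  have lim_bound: "\<bar>m * heat_kernel c x\<bar> \<le> M" for x
  proof -
    have "\<bar>m\<bar> * \<bar>heat_kernel c x\<bar> \<le> (\<integral>y. \<bar>w y\<bar> \<partial>lborel) * (1 / sqrt (4 * pi * c))"
      unfolding m_def using heat_kernel_le[OF c, of x] c
      by (intro mult_mono integral_abs_bound) auto
    then show ?thesis by (simp add: M_def abs_mult)
  qed
  show vp: "integrable lborel (\<lambda>x. \<bar>rescaled c w s x\<bar> powr p)" for s
    by (rule integrable_powr_bounded[OF v v_bound p])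
  have limp: "integrable lborel (\<lambda>x. \<bar>m * heat_kernel c x\<bar> powr p)"
    by (rule integrable_powr_bounded[OF lim lim_bound p])
  define I where "I = (\<integral>x. \<bar>m * heat_kernel c x\<bar> powr p \<partial>lborel)"
  have "norm ((\<integral>x. \<bar>rescaled c w s x\<bar> powr p \<partial>lborel) - I)
      \<le> p * M powr (p - 1) * (\<integral>x. \<bar>d s x\<bar> \<partial>lborel)" for s
  proof -
    have "\<bar>(\<integral>x. \<bar>rescaled c w s x\<bar> powr p \<partial>lborel) - I\<bar>
        = \<bar>\<integral>x. \<bar>rescaled c w s x\<bar> powr p - \<bar>m * heat_kernel c x\<bar> powr p \<partial>lborel\<bar>"
      unfolding I_def using vp limp by simp
    also have "\<dots> \<le> (\<integral>x. \<bar>\<bar>rescaled c w s x\<bar> powr p - \<bar>m * heat_kernel c x\<bar> powr p\<bar> \<partial>lborel)"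
      by (rule integral_abs_bound)
    also have "\<dots> \<le> (\<integral>x. p * M powr (p - 1) * \<bar>d s x\<bar> \<partial>lborel)"
    proof (rule integral_mono)
      fix x
      have "\<bar>\<bar>rescaled c w s x\<bar> powr p - \<bar>m * heat_kernel c x\<bar> powr p\<bar>
          \<le> p * M powr (p - 1) * \<bar>\<bar>rescaled c w s x\<bar> - \<bar>m * heat_kernel c x\<bar>\<bar>"
        using p v_bound lim_bound by (intro powr_Lipschitz_on_bounded) auto
      also have "\<dots> \<le> p * M powr (p - 1) * \<bar>d s x\<bar>"
        unfolding d_def using p by (intro mult_left_mono abs_triangle_ineq3) auto
      finally show "\<bar>\<bar>rescaled c w s x\<bar> powr p - \<bar>m * heat_kernel c x\<bar> powr p\<bar>
          \<le> p * M powr (p - 1) * \<bar>d s x\<bar>" .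
    qed (use vp limp d in auto)
    finally show ?thesis by simp
  qed
  moreover have "((\<lambda>s. p * M powr (p - 1) * (\<integral>x. \<bar>d s x\<bar> \<partial>lborel)) \<longlongrightarrow> 0) at_top"
    by (rule tendsto_mult_right_zero[OF d(2)])
  ultimately have "((\<lambda>s. (\<integral>x. \<bar>rescaled c w s x\<bar> powr p \<partial>lborel) - I) \<longlongrightarrow> 0) at_top"
    by (rule Lim_null_comparison[OF always_eventually[OF allI]])
  then have "((\<lambda>s. \<integral>x. \<bar>rescaled c w s x\<bar> powr p \<partial>lborel) \<longlongrightarrow> I) at_top"
    by (simp add: LIM_zero_iff)
  moreover have "I = (\<bar>m\<bar> / sqrt (4 * pi * c)) powr p * sqrt (4 * pi * c / p)"
  proof -
    have "I = (\<integral>x. \<bar>m\<bar> powr p * heat_kernel c x powr p \<partial>lborel)"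
      unfolding I_def using c by (simp add: abs_mult powr_mult)
    also have "\<dots> = \<bar>m\<bar> powr p * ((1 / sqrt (4 * pi * c)) powr p * sqrt (4 * pi * c / p))"
      using has_bochner_integral_heat_kernel_powr[OF c, of p] p
      by (simp add: has_bochner_integral_iff)
    also have "\<dots> = (\<bar>m\<bar> / sqrt (4 * pi * c)) powr p * sqrt (4 * pi * c / p)"
      using c by (simp add: powr_divide)
    finally show ?thesis .
  qed
  ultimately show "((\<lambda>s. \<integral>x. \<bar>rescaled c w s x\<bar> powr p \<partial>lborel)
      \<longlongrightarrow> (\<bar>m\<bar> / sqrt (4 * pi * c)) powr p * sqrt (4 * pi * c / p)) at_top"
    by simp
qed

text \<open>The uniform limit \<open>m G\<close> attains its supremum norm at the origin, which gives the lower bound.\<close>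

lemma rescaled_Linf_convergence:
  assumes c: "c > 0" and w: "integrable lborel w"
  shows "((\<lambda>s. Linf_norm (rescaled c w s))
      \<longlongrightarrow> ennreal (\<bar>\<integral>y. w y \<partial>lborel\<bar> / sqrt (4 * pi * c))) at_top"
proof -
  define m where "m = (\<integral>y. w y \<partial>lborel)"
  define A where "A = \<bar>m\<bar> / sqrt (4 * pi * c)"
  obtain \<delta> where \<delta>: "(\<delta> \<longlongrightarrow> 0) at_top"
    "\<And>s x. \<bar>rescaled c w s x - m * heat_kernel c x\<bar> \<le> \<delta> s"
    unfolding m_def using rescaled_uniform_convergence[OF c w] by blast
  have lower: "ennreal (A - \<delta> s) \<le> Linf_norm (rescaled c w s)" for s
  proof -
    have "\<bar>m * heat_kernel c 0\<bar> = A" using c by (simp add: A_def heat_kernel_0 abs_mult)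
    then have "A - \<delta> s \<le> \<bar>rescaled c w s 0\<bar>" using \<delta>(2)[of s 0] by linarith
    then have "ennreal (A - \<delta> s) \<le> ennreal \<bar>rescaled c w s 0\<bar>" by (rule ennreal_leI)
    also have "\<dots> \<le> Linf_norm (rescaled c w s)"
      unfolding Linf_norm_def by (rule SUP_upper) simp
    finally show ?thesis .
  qed
  have upper: "Linf_norm (rescaled c w s) \<le> ennreal (A + \<delta> s)" for s
    unfolding Linf_norm_def
  proof (rule SUP_least, rule ennreal_leI)
    fix x
    have "\<bar>m\<bar> * heat_kernel c x \<le> \<bar>m\<bar> * (1 / sqrt (4 * pi * c))"
      by (intro mult_left_mono heat_kernel_le c) auto
    then have "\<bar>m * heat_kernel c x\<bar> \<le> A" using c by (simp add: A_def abs_mult)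
    then show "\<bar>rescaled c w s x\<bar> \<le> A + \<delta> s" using \<delta>(2)[of s x] by linarith
  qed
  have "((\<lambda>s. ennreal (A - \<delta> s)) \<longlongrightarrow> ennreal A) at_top"
    using tendsto_ennrealI[OF tendsto_diff[OF tendsto_const \<delta>(1), of A]] by simp
  moreover have "((\<lambda>s. ennreal (A + \<delta> s)) \<longlongrightarrow> ennreal A) at_top"
    using tendsto_ennrealI[OF tendsto_add[OF tendsto_const \<delta>(1), of A]] by simp
  ultimately have "((\<lambda>s. Linf_norm (rescaled c w s)) \<longlongrightarrow> ennreal A) at_top"
    by (rule tendsto_sandwich[OF always_eventually[OF allI, OF lower]
          always_eventually[OF allI, OF upper]])
  then show ?thesis by (simp add: A_def m_def)
qed

section \<open>Norms under parabolic scaling\<close>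

text \<open>The substitution \<open>x = s z\<close> contributes \<open>s\<close> and the amplitude contributes \<open>s\<^bsup>-p\<^esup>\<close>; the \<open>p\<close>-th root of
  their product is the inverse of the prefactor. With \<open>s = \<surd>t\<close> the prefactor is
  \<open>t\<^bsup>(1-1/p)/2\<^esup>\<close>.\<close>

lemma scaled_Lp_norm:
  assumes [measurable]: "v \<in> borel_measurable borel"
    and v: "integrable lborel (\<lambda>x. \<bar>v x\<bar> powr p)" and "p \<ge> 1" "s > 0"
  shows "ennreal (s powr (1 - 1 / p)) * Lp_norm p (\<lambda>x. v (x / s) / s)
       = ennreal ((\<integral>x. \<bar>v x\<bar> powr p \<partial>lborel) powr (1 / p))"
proof -
  define I where "I = (\<integral>x. \<bar>v x\<bar> powr p \<partial>lborel)"
  have "I \<ge> 0" by (simp add: I_def)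
  have "(\<integral>\<^sup>+x. ennreal (\<bar>v (x / s) / s\<bar> powr p) \<partial>lebesgue)
      = (\<integral>\<^sup>+x. ennreal (\<bar>v (x / s) / s\<bar> powr p) \<partial>lborel)"
    by (rule nn_integral_completion)
  also have "\<dots> = ennreal s * (\<integral>\<^sup>+x. ennreal (s powr - p * \<bar>v x\<bar> powr p) \<partial>lborel)"
    using \<open>s > 0\<close>
    by (subst nn_integral_real_affine[where c = s and t = 0])
      (auto simp: powr_divide powr_minus_divide mult.commute)
  also have "\<dots> = ennreal (s * (s powr - p * I))"
    using v \<open>s > 0\<close> \<open>I \<ge> 0\<close> by (subst nn_integral_eq_integral) (auto simp: I_def ennreal_mult)
  also have "s * (s powr - p * I) = s powr (1 - p) * I"
    using \<open>s > 0\<close> by (simp add: powr_diff powr_minus_divide)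
  finally have "Lp_norm p (\<lambda>x. v (x / s) / s) = ennreal ((s powr (1 - p) * I) powr (1 / p))"
    using \<open>I \<ge> 0\<close> by (simp add: Lp_norm_def Let_def)
  also have "(s powr (1 - p) * I) powr (1 / p) = s powr ((1 - p) / p) * I powr (1 / p)"
    using \<open>I \<ge> 0\<close> by (simp add: powr_mult powr_powr)
  also have "(1 - p) / p = - (1 - 1 / p)"
    using \<open>p \<ge> 1\<close> by (simp add: field_simps)
  finally show ?thesis
    using \<open>s > 0\<close> by (simp add: I_def flip: ennreal_mult powr_add mult.assoc)
qed

lemma scaled_Linf_norm:
  assumes "s > 0"
  shows "ennreal s * Linf_norm (\<lambda>x. v (x / s) / s) = Linf_norm v"
proof -
  have "ennreal s * Linf_norm (\<lambda>x. v (x / s) / s)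
      = (SUP x. ennreal s * ennreal \<bar>v (x / s) / s\<bar>)"
    unfolding Linf_norm_def by (simp add: SUP_mult_left_ennreal)
  also have "\<dots> = (SUP x. ennreal \<bar>v (x / s)\<bar>)"
    using assms by (simp flip: ennreal_mult)
  also have "\<dots> = (SUP x \<in> range (\<lambda>x. x / s). ennreal \<bar>v x\<bar>)"
    by (simp add: image_image)
  also have "range (\<lambda>x. x / s) = UNIV"
    using assms by (intro surjI[where f = "\<lambda>x. x * s"]) auto
  finally show ?thesis by (simp add: Linf_norm_def)
qed

lemma heat_representation_rescaled:
  assumes c: "c > 0" and rep: "heat_representation c u0 u" and u0: "integrable lebesgue u0"
    and [measurable]: "w \<in> borel_measurable borel" and ae: "AE x in lborel. u0 x = w x"
    and "s > 0"
  shows "u x (s\<^sup>2) = rescaled c w s (x / s) / s"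
proof -
  have [measurable]: "u0 \<in> borel_measurable lebesgue" using u0 by simp
  let ?E = "\<lambda>y. exp (- ((x - y)\<^sup>2 / (4 * c * s\<^sup>2)))"
  have "(\<integral>y. ?E y * u0 y \<partial>lebesgue) = (\<integral>y. ?E y * w y \<partial>lebesgue)"
  proof (rule integral_cong_AE)
    have [measurable]: "?E \<in> borel_measurable lebesgue" "w \<in> borel_measurable lebesgue"
      by (auto intro!: measurable_completion)
    show "(\<lambda>y. ?E y * u0 y) \<in> borel_measurable lebesgue"
      "(\<lambda>y. ?E y * w y) \<in> borel_measurable lebesgue" by measurable
    show "AE y in lebesgue. ?E y * u0 y = ?E y * w y"
      using AE_completion[OF ae] by eventually_elim simp
  qed
  also have "\<dots> = (\<integral>y. ?E y * w y \<partial>lborel)"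
    by (intro integral_completion) measurable
  finally have u: "u x (s\<^sup>2) = 1 / sqrt (4 * pi * c * s\<^sup>2) * (\<integral>y. ?E y * w y \<partial>lborel)"
    using rep \<open>s > 0\<close> by (simp add: heat_representation_def)
  have kernel: "heat_kernel c (x / s - y / s) = 1 / sqrt (4 * pi * c) * ?E y" for y
    using \<open>s > 0\<close>
    by (simp add: heat_kernel_def power_divide mult.commute flip: diff_divide_distrib)
  have "rescaled c w s (x / s) = 1 / sqrt (4 * pi * c) * (\<integral>y. ?E y * w y \<partial>lborel)"
    unfolding rescaled_def kernel mult.assoc by (rule integral_mult_right_zero)
  then show ?thesis
    unfolding u using \<open>s > 0\<close> by (simp add: real_sqrt_mult)
qed

lemma Lp_limit_constant:
  fixes c m p :: real
  assumes "c > 0" "p \<ge> 1"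
  shows "((\<bar>m\<bar> / sqrt (4 * pi * c)) powr p * sqrt (4 * pi * c / p)) powr (1 / p)
       = \<bar>m\<bar> / sqrt (4 * pi * c) * (4 * pi * c / p) powr (1 / (2 * p))"
proof -
  have "((\<bar>m\<bar> / sqrt (4 * pi * c)) powr p * sqrt (4 * pi * c / p)) powr (1 / p)
      = ((\<bar>m\<bar> / sqrt (4 * pi * c)) powr p) powr (1 / p) * sqrt (4 * pi * c / p) powr (1 / p)"
    using assms by (intro powr_mult)
  also have "((\<bar>m\<bar> / sqrt (4 * pi * c)) powr p) powr (1 / p) = \<bar>m\<bar> / sqrt (4 * pi * c)"
    using assms by (simp add: powr_powr)
  also have "sqrt (4 * pi * c / p) powr (1 / p) = (4 * pi * c / p) powr (1 / (2 * p))"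
    using assms by (simp add: powr_half_sqrt[symmetric] powr_powr del: real_sqrt_divide)
  finally show ?thesis .
qed

theorem theorem1:
  fixes c m :: real and u0 :: "real \<Rightarrow> real" and u :: "real \<Rightarrow> real \<Rightarrow> real"
  assumes "c > 0"
    and "integrable lebesgue u0"
    and "m = (\<integral>x. u0 x \<partial>lebesgue)"
    and "solves_heat_equation c u"
    and "has_initial_value u u0"
    and "heat_representation c u0 u"
  shows "((\<lambda>t. Lp_norm 1 (\<lambda>x. u x t)) \<longlongrightarrow> ennreal \<bar>m\<bar>) at_top \<and>
    (\<forall>p\<ge>1. ((\<lambda>t. ennreal (t powr (1 / 2 * (1 - 1 / p))) * Lp_norm p (\<lambda>x. u x t)) \<longlongrightarrow>
        ennreal (\<bar>m\<bar> / sqrt (4 * pi * c) * (4 * pi * c / p) powr (1 / (2 * p)))) at_top) \<and>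
    ((\<lambda>t. ennreal (t powr (1 / 2)) * Linf_norm (\<lambda>x. u x t)) \<longlongrightarrow>
        ennreal (\<bar>m\<bar> / sqrt (4 * pi * c))) at_top"
proof -
  \<comment> \<open>A Borel version of \<open>u\<^sub>0\<close> makes product measurability, and so Tonelli's theorem, available.\<close>
  obtain w where w_meas: "w \<in> borel_measurable borel" and ae: "AE x in lborel. u0 x = w x"
    using completion_ex_borel_measurable_real[of u0 lborel] assms(2) by auto
  have w_meas': "w \<in> borel_measurable lebesgue"
    using w_meas by (auto intro!: measurable_completion)
  have u0_meas: "u0 \<in> borel_measurable lebesgue" using assms(2) by simp
  have "integrable lebesgue w"
    using integrable_cong_AE[OF u0_meas w_meas' AE_completion[OF ae]] assms(2) by simp
  then have w: "integrable lborel w"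
    using w_meas by (simp add: integrable_completion)
  have m: "m = (\<integral>x. w x \<partial>lborel)"
    unfolding assms(3) integral_cong_AE[OF u0_meas w_meas' AE_completion[OF ae]]
    using w_meas by (simp add: integral_completion)
  have u: "u x t = rescaled c w (sqrt t) (x / sqrt t) / sqrt t" if "t > 0" for x t
    using heat_representation_rescaled[OF assms(1,6,2) w_meas ae, of "sqrt t" x] that by simp
  have sqrt_lim: "filterlim sqrt at_top at_top" by (rule sqrt_at_top)

  have Lp: "((\<lambda>t. ennreal (t powr (1 / 2 * (1 - 1 / p))) * Lp_norm p (\<lambda>x. u x t)) \<longlongrightarrow>
        ennreal (\<bar>m\<bar> / sqrt (4 * pi * c) * (4 * pi * c / p) powr (1 / (2 * p)))) at_top"
    if p: "p \<ge> 1" for p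
  proof -
    have "((\<lambda>s. ennreal ((\<integral>x. \<bar>rescaled c w s x\<bar> powr p \<partial>lborel) powr (1 / p))) \<longlongrightarrow>
        ennreal (\<bar>m\<bar> / sqrt (4 * pi * c) * (4 * pi * c / p) powr (1 / (2 * p)))) at_top"
      \<comment> \<open>For \<open>m = 0\<close> the integrals tend to \<open>0\<close>; the root is still continuous there along nonnegative
        values, since its exponent is positive.\<close>
      unfolding Lp_limit_constant[OF assms(1) p, symmetric] m using p
      by (intro tendsto_ennrealI tendsto_powr' tendsto_const
          rescaled_Lp_convergence[OF assms(1) w p]) auto
    from filterlim_compose[OF this sqrt_lim] show ?thesis
    proof (rule Lim_transform_eventually)
      show "\<forall>\<^sub>F t in at_top.
          ennreal ((\<integral>x. \<bar>rescaled c w (sqrt t) x\<bar> powr p \<partial>lborel) powr (1 / p))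
          = ennreal (t powr (1 / 2 * (1 - 1 / p))) * Lp_norm p (\<lambda>x. u x t)"
        using eventually_gt_at_top[of 0]
      proof eventually_elim
        case (elim t)
        have "t powr (1 / 2 * (1 - 1 / p)) = sqrt t powr (1 - 1 / p)"
          using elim by (simp add: powr_half_sqrt[symmetric] powr_powr)
        then show ?case
          using scaled_Lp_norm[OF borel_measurable_rescaled[OF w_meas]
              rescaled_Lp_convergence(1)[OF assms(1) w p, of "sqrt t"] p, of "sqrt t"]
            elim u[OF elim]
          by simp
      qed
    qed
  qed

  have "((\<lambda>t. Lp_norm 1 (\<lambda>x. u x t)) \<longlongrightarrow> ennreal \<bar>m\<bar>) at_top"
  proof (rule Lim_transform_eventually)
    have "\<bar>m\<bar> / sqrt (4 * pi * c) * (4 * pi * c / 1) powr (1 / (2 * 1)) = \<bar>m\<bar>"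
      using assms(1) by (simp add: powr_half_sqrt)
    then show "((\<lambda>t. ennreal (t powr (1 / 2 * (1 - 1 / 1))) * Lp_norm 1 (\<lambda>x. u x t))
        \<longlongrightarrow> ennreal \<bar>m\<bar>) at_top"
      using Lp[of 1] by simp
    show "\<forall>\<^sub>F t in at_top. ennreal (t powr (1 / 2 * (1 - 1 / 1))) * Lp_norm 1 (\<lambda>x. u x t)
        = Lp_norm 1 (\<lambda>x. u x t)"
      using eventually_gt_at_top[of 0] by eventually_elim simp
  qed
  moreover have "((\<lambda>t. ennreal (t powr (1 / 2)) * Linf_norm (\<lambda>x. u x t)) \<longlongrightarrow>
        ennreal (\<bar>m\<bar> / sqrt (4 * pi * c))) at_top"
    unfolding m
    using filterlim_compose[OF rescaled_Linf_convergence[OF assms(1) w] sqrt_lim]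
  proof (rule Lim_transform_eventually)
    show "\<forall>\<^sub>F t in at_top. Linf_norm (rescaled c w (sqrt t))
        = ennreal (t powr (1 / 2)) * Linf_norm (\<lambda>x. u x t)"
      using eventually_gt_at_top[of 0]
    proof eventually_elim
      case (elim t)
      then show ?case
        using scaled_Linf_norm[of "sqrt t" "rescaled c w (sqrt t)"] u[OF elim]
        by (simp add: powr_half_sqrt)
    qed
  qed
  ultimately show ?thesis using Lp by blast
qed

end
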